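(* Let $\lambda,\mu,\alpha>0$ and let $Y(t)=(Q_1(t),Q_2(t),C(t))$ be the irreducible continuous-time Markov chain described in the context. The system is stable (that is, $Y$ is positive recurrent) if and only if $$\rho:=\frac{\lambda(\lambda+2\alpha)}{2\alpha\mu}<1.$$
   Context: $Y(t)$ is a continuous-time Markov chain on $\{0,1,\ldots\}\times\{0,1,\ldots\}\times\{0,1\}$ modelling a single-server retrial system with two infinite-capacity orbit queues: $Q_l(t)$ is the number of jobs in orbit $l$ and $C(t)$ the server state ($1$ = busy, $0$ = idle). Transition rates: - from $(i,j,0)$: to $(i,j,1)$ at rate $\lambda$; to $(i-1,j,1)$ at rate $\alpha$ if $i>0$; to $(i,j-1,1)$ at rate $\alpha$ if $j>0$; - from $(i,j,1)$: to $(i,j,0)$ at rate $\mu$; to $(i+1,j,1)$ at rate $\lambda$ if $i<j$; to $(i,j+1,1)$ at rate $\lambda$ if $j<i$; if $i=j$, to each of $(i+1,j,1)$ and $(i,j+1,1)$ at rate $\lambda/2$. *)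

theory Defs
  imports "HOL-Probability.Probability"
begin

section \<open>Continuous-time Markov chains given by transition rates\<close>

text \<open>
  A chain on a countable state space is given by its off-diagonal transition rates
  \<open>q x y\<close>, \<open>x \<noteq> y\<close>; the diagonal of \<open>q\<close> is never used. Every state is meant to have a
  finite and strictly positive total exit rate (no absorbing states).
\<close>

definition exit_rate :: "('s \<Rightarrow> 's \<Rightarrow> real) \<Rightarrow> 's \<Rightarrow> real" where
  "exit_rate q x = (\<Sum>\<^sub>\<infinity>y\<in>-{x}. q x y)"

definition jump_prob :: "('s \<Rightarrow> 's \<Rightarrow> real) \<Rightarrow> 's \<Rightarrow> 's \<Rightarrow> real" where
  "jump_prob q x y = (if y = x then 0 else q x y / exit_rate q x)"

text \<open>
  The jump chain \<open>Z\<close> is a discrete-time Markov chain started in \<open>x\<close> with transition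
  matrix \<open>jump_prob q\<close> and, conditionally on \<open>Z 0, \<dots>, Z n\<close>, the holding times
  \<open>S 0, \<dots>, S n\<close> are independent and exponential with parameters
  \<open>exit_rate q (Z 0), \<dots>, exit_rate q (Z n)\<close>. Both requirements are written as one formula
  for the joint law.
\<close>

definition jump_hold_law ::
  "'w measure \<Rightarrow> ('s \<Rightarrow> 's \<Rightarrow> real) \<Rightarrow> 's \<Rightarrow> (nat \<Rightarrow> 'w \<Rightarrow> 's) \<Rightarrow> (nat \<Rightarrow> 'w \<Rightarrow> real) \<Rightarrow> bool"
where
  "jump_hold_law M q x Z S \<longleftrightarrow>
     (\<forall>n. Z n \<in> measurable M (count_space UNIV)) \<and>
     (\<forall>n. S n \<in> borel_measurable M) \<and>
     (\<forall>n z t. (\<forall>k\<le>n. 0 \<le> t k) \<longrightarrow>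
        measure M {\<omega> \<in> space M. \<forall>k\<le>n. Z k \<omega> = z k \<and> S k \<omega> > t k} =
          of_bool (z 0 = x) * (\<Prod>k<n. jump_prob q (z k) (z (Suc k)))
            * (\<Prod>k\<le>n. exp (- exit_rate q (z k) * t k)))"

text \<open>
  \<open>Y\<close> is a Markov chain with rates \<open>q\<close> started in \<open>x\<close>: it sits in \<open>Z n\<close> between the jump
  times \<open>S 0 + \<dots> + S (n - 1)\<close> (included) and \<open>S 0 + \<dots> + S n\<close> (excluded). Only \<open>Y t\<close> for
  \<open>t \<ge> 0\<close> matters. Nothing is required of \<open>Y\<close> after an explosion; for bounded exit rates
  explosion has probability 0.
\<close>

definition ctmc_from ::
  "'w measure \<Rightarrow> ('s \<Rightarrow> 's \<Rightarrow> real) \<Rightarrow> 's \<Rightarrow> (real \<Rightarrow> 'w \<Rightarrow> 's) \<Rightarrow> bool"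
where
  "ctmc_from M q x Y \<longleftrightarrow>
     prob_space M \<and>
     (\<forall>t\<ge>0. Y t \<in> measurable M (count_space UNIV)) \<and>
     (\<exists>Z S. jump_hold_law M q x Z S \<and>
        (AE \<omega> in M. \<forall>n t. (\<Sum>k<n. S k \<omega>) \<le> t \<and> t < (\<Sum>k<Suc n. S k \<omega>) \<longrightarrow>
                        Y t \<omega> = Z n \<omega>))"

text \<open>The law \<open>P x\<close> plays the role of the conditional law given \<open>Y 0 = x\<close>.\<close>

definition ctmc ::
  "('s \<Rightarrow> 'w measure) \<Rightarrow> ('s \<Rightarrow> 's \<Rightarrow> real) \<Rightarrow> (real \<Rightarrow> 'w \<Rightarrow> 's) \<Rightarrow> bool"
where
  "ctmc P q Y \<longleftrightarrow> (\<forall>x. ctmc_from (P x) q x Y)"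

definition irreducible_rates :: "('s \<Rightarrow> 's \<Rightarrow> real) \<Rightarrow> bool" where
  "irreducible_rates q \<longleftrightarrow> (\<forall>x y. (x, y) \<in> {(a, b). a \<noteq> b \<and> q a b > 0}\<^sup>*)"

text \<open>First time the process is in \<open>x\<close> after having left it (\<open>\<infinity>\<close> if there is none).\<close>

definition return_time :: "(real \<Rightarrow> 'w \<Rightarrow> 's) \<Rightarrow> 's \<Rightarrow> 'w \<Rightarrow> ennreal" where
  "return_time Y x \<omega> =
     (INF t \<in> {t. 0 \<le> t \<and> Y t \<omega> = x \<and> (\<exists>s. 0 \<le> s \<and> s < t \<and> Y s \<omega> \<noteq> x)}. ennreal t)"

definition positive_recurrent ::
  "('s \<Rightarrow> 'w measure) \<Rightarrow> (real \<Rightarrow> 'w \<Rightarrow> 's) \<Rightarrow> bool"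
where
  "positive_recurrent P Y \<longleftrightarrow> (\<forall>x. (\<integral>\<^sup>+\<omega>. return_time Y x \<omega> \<partial>P x) < \<infinity>)"


section \<open>The retrial system with two orbit queues\<close>

text \<open>\<open>(i, j, c)\<close>: \<open>i\<close> and \<open>j\<close> jobs in the two orbits; the server is busy iff \<open>c\<close>.\<close>

type_synonym state = "nat \<times> nat \<times> bool"

fun retrial_rate :: "real \<Rightarrow> real \<Rightarrow> real \<Rightarrow> state \<Rightarrow> state \<Rightarrow> real" where
  "retrial_rate lam mu alpha (i, j, False) y =
     (if y = (i, j, True) then lam
      else if i > 0 \<and> y = (i - 1, j, True) then alpha
      else if j > 0 \<and> y = (i, j - 1, True) then alpha
      else 0)"
| "retrial_rate lam mu alpha (i, j, True) y =
     (if y = (i, j, False) then mu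
      else if y = (i + 1, j, True) then
        (if i < j then lam else if i = j then lam / 2 else 0)
      else if y = (i, j + 1, True) then
        (if j < i then lam else if i = j then lam / 2 else 0)
      else 0)"

lemma exit_rate_retrial_idle:
  "exit_rate (retrial_rate lam mu alpha) (i, j, False) =
     lam + of_bool (i > 0) * alpha + of_bool (j > 0) * alpha"
proof -
  let ?A = "{(i, j, True)} \<union> (if i > 0 then {(i - 1, j, True)} else {})
      \<union> (if j > 0 then {(i, j - 1, True)} else {})"
  have "exit_rate (retrial_rate lam mu alpha) (i, j, False) =
      infsum (retrial_rate lam mu alpha (i, j, False)) ?A"
    unfolding exit_rate_def by (rule infsum_cong_neutral) (auto split: if_splits)
  also have "\<dots> = sum (retrial_rate lam mu alpha (i, j, False)) ?A"
    by (rule infsum_finite) auto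
  also have "\<dots> = lam + of_bool (i > 0) * alpha + of_bool (j > 0) * alpha"
    by auto
  finally show ?thesis .
qed

lemma exit_rate_retrial_busy:
  "exit_rate (retrial_rate lam mu alpha) (i, j, True) = mu + lam"
proof -
  let ?A = "{(i, j, False), (i + 1, j, True), (i, j + 1, True)}"
  have "exit_rate (retrial_rate lam mu alpha) (i, j, True) =
      infsum (retrial_rate lam mu alpha (i, j, True)) ?A"
    unfolding exit_rate_def by (rule infsum_cong_neutral) (auto split: if_splits)
  also have "\<dots> = sum (retrial_rate lam mu alpha (i, j, True)) ?A"
    by (rule infsum_finite) auto
  also have "\<dots> = mu + lam"
    by auto
  finally show ?thesis .
qed

lemma irreducible_retrial_rate:
  assumes "lam > 0" "mu > 0" "alpha > 0"
  shows "irreducible_rates (retrial_rate lam mu alpha)"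
proof -
  let ?R = "{(a, b). a \<noteq> b \<and> retrial_rate lam mu alpha a b > 0}"
  have arr: "((i, j, False), (i, j, True)) \<in> ?R\<^sup>*" for i j
    using assms by (intro r_into_rtrancl) auto
  have srv: "((i, j, True), (i, j, False)) \<in> ?R\<^sup>*" for i j
    using assms by (intro r_into_rtrancl) auto
  have ret1: "((Suc i, j, False), (i, j, True)) \<in> ?R\<^sup>*" for i j
    using assms by (intro r_into_rtrancl) auto
  have down1: "((Suc i, j, True), (i, j, True)) \<in> ?R\<^sup>*" for i j
    by (rule rtrancl_trans[OF srv ret1])
  have ret2: "((i, Suc j, False), (i, j, True)) \<in> ?R\<^sup>*" for i j
    using assms by (intro r_into_rtrancl) auto
  have down2: "((i, Suc j, True), (i, j, True)) \<in> ?R\<^sup>*" for i j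
    by (rule rtrancl_trans[OF srv ret2])
  have down1': "((i + k, j, True), (i, j, True)) \<in> ?R\<^sup>*" for i j k
  proof (induction k)
    case (Suc k)
    from rtrancl_trans[OF down1 Suc] show ?case by simp
  qed simp
  have down2': "((i, j + k, True), (i, j, True)) \<in> ?R\<^sup>*" for i j k
  proof (induction k)
    case (Suc k)
    from rtrancl_trans[OF down2 Suc] show ?case by simp
  qed simp
  have diag1: "((n, n, True), (Suc n, n, True)) \<in> ?R\<^sup>*" for n
    using assms by (intro r_into_rtrancl) auto
  have diag2: "((Suc n, n, True), (Suc n, Suc n, True)) \<in> ?R\<^sup>*" for n
    using assms by (intro r_into_rtrancl) auto
  have diag: "((n, n, True), (Suc n, Suc n, True)) \<in> ?R\<^sup>*" for n
    by (rule rtrancl_trans[OF diag1 diag2])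
  have up: "((0, 0, True), (n, n, True)) \<in> ?R\<^sup>*" for n
  proof (induction n)
    case (Suc n)
    from rtrancl_trans[OF Suc diag] show ?case .
  qed simp
  have to_zero: "((i, j, c), (0, 0, True)) \<in> ?R\<^sup>*" for i j c
  proof -
    have "((i, j, c), (i, j, True)) \<in> ?R\<^sup>*" using arr by (cases c) auto
    also have "((i, j, True), (0, j, True)) \<in> ?R\<^sup>*" using down1'[of 0 i j] by simp
    also have "((0, j, True), (0, 0, True)) \<in> ?R\<^sup>*" using down2'[of 0 0 j] by simp
    finally show ?thesis .
  qed
  have from_zero: "((0, 0, True), (i, j, c)) \<in> ?R\<^sup>*" for i j c
  proof -
    have "((0, 0, True), (i + j, i + j, True)) \<in> ?R\<^sup>*" by (rule up)
    also have "((i + j, i + j, True), (i, i + j, True)) \<in> ?R\<^sup>*" by (rule down1')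
    also have "((i, i + j, True), (i, j, True)) \<in> ?R\<^sup>*"
      using down2'[of i j i] by (simp add: add.commute)
    also have "((i, j, True), (i, j, c)) \<in> ?R\<^sup>*" using srv by (cases c) auto
    finally show ?thesis .
  qed
  show ?thesis
    unfolding irreducible_rates_def
    by (auto simp only: split_paired_All intro!: rtrancl_trans[OF to_zero from_zero])
qed

end

theory Submission
  imports Defs
begin

text \<open>
  Let \<open>T\<close> be the kernel of the jump chain killed at a state \<open>x\<close> and \<open>m\<close> the mean holding time as a
  function of the state. The mean return time to \<open>x\<close> is finite iff the sum over \<open>k\<close> of
  \<open>(T ^^ k) m x\<close> is finite (\<open>return_time_finite_iff\<close>): the return time is compared path by path with
  the sum of the holding times before the jump chain comes back, and the expectation of each of
  these is computed from the joint law (\<open>path_integral\<close>). What remains concerns nonnegative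
  kernels only.

  For a load below one, the quadratic function \<open>i\<^sup>2 + j\<^sup>2\<close>, plus \<open>b * (i + j)\<close> when the server is busy,
  has drift at most \<open>-1\<close> outside a finite set for a suitable \<open>b\<close>. Foster's criterion (\<open>foster\<close>)
  then makes every mean return time finite; it reaches single states by adding a bounded function
  whose drift is negative everywhere off the target, which irreducibility provides.

  For a load of at least one, the linear function \<open>i + j\<close>, plus a suitable \<open>a\<close> when the server is
  busy, has nonnegative drift everywhere, vanishes at the empty idle state and has increments of at
  most one. The probability of avoiding that state for \<open>n\<close> jumps is then at least of order \<open>1 / n\<close>,
  so the mean return time is infinite (\<open>excursion_infinite_of_submartingale\<close>). This covers the
  critical case as well, where the chain may still be recurrent.
\<close>

section \<open>Path integrals of a jump chain with holding times\<close>

text \<open>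
  One step of the jump chain, killed on leaving \<open>A\<close>. Started in \<open>x\<close>,
  \<open>(killed_step q A ^^ k) h x\<close> is the expectation of \<open>h (Z k)\<close> on the event that
  \<open>Z 1, \<dots>, Z k\<close> all lie in \<open>A\<close>; the starting point is exempt, which is what a first return
  requires. Values in \<open>ennreal\<close> make infinite expectations harmless.
\<close>

definition killed_step ::
  "('s \<Rightarrow> 's \<Rightarrow> real) \<Rightarrow> 's set \<Rightarrow> ('s \<Rightarrow> ennreal) \<Rightarrow> 's \<Rightarrow> ennreal"
where
  "killed_step q A h y = (\<integral>\<^sup>+z. ennreal (jump_prob q y z) * indicator A z * h z \<partial>count_space UNIV)"

lemma killed_step_mono:
  assumes "\<And>z. z \<in> A \<Longrightarrow> g z \<le> h z"
  shows "killed_step q A g y \<le> killed_step q A h y"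
  unfolding killed_step_def using assms
  by (intro nn_integral_mono) (auto split: split_indicator intro: mult_left_mono)

lemma killed_step_cmult:
  "killed_step q A (\<lambda>z. c * h z) y = c * killed_step q A h y"
  unfolding killed_step_def by (subst nn_integral_cmult[symmetric]) (auto simp: ac_simps)

lemma killed_step_sum:
  "finite I \<Longrightarrow> killed_step q A (\<lambda>z. \<Sum>i\<in>I. h i z) y = (\<Sum>i\<in>I. killed_step q A (h i) y)"
  unfolding killed_step_def by (subst nn_integral_sum[symmetric]) (auto simp: sum_distrib_left)

lemma killed_step_ge_single:
  assumes "z \<in> A"
  shows "ennreal (jump_prob q y z) * h z \<le> killed_step q A h y"
proof -
  have "ennreal (jump_prob q y z) * h z =
      (\<integral>\<^sup>+w. ennreal (jump_prob q y w) * indicator {z} w * h w \<partial>count_space UNIV)"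
    by (subst nn_integral_count_space'[where A = "{z}"]) auto
  also have "\<dots> \<le> killed_step q A h y"
    unfolding killed_step_def using assms
    by (intro nn_integral_mono) (auto split: split_indicator)
  finally show ?thesis .
qed

text \<open>
  The Markov property in the only form needed. The law of the chain is given on cylinders
  \<open>Z 0 = z 0, \<dots>, Z n = z n\<close>; summing over the last coordinate turns a cylinder of length
  \<open>n + 1\<close> into one application of the killed kernel, so induction on the number \<open>m\<close> of
  unspecified steps works backwards from a base case in which the whole path is prescribed.
  The holding times are kept positive throughout because the law only speaks of events
  \<open>S k > t k\<close> with \<open>t k \<ge> 0\<close>.
\<close>

lemma path_integral:
  fixes Z :: "nat \<Rightarrow> 'w \<Rightarrow> 's::countable" and S :: "nat \<Rightarrow> 'w \<Rightarrow> real"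
  assumes Z[measurable]: "\<And>n. Z n \<in> measurable M (count_space UNIV)"
    and S[measurable]: "\<And>n. S n \<in> borel_measurable M"
    and f[measurable]: "f \<in> borel_measurable borel"
    and p: "\<And>y z. 0 \<le> jump_prob q y z"
    and base: "\<And>n z. z 0 = x \<Longrightarrow>
      (\<integral>\<^sup>+\<omega>. indicator {\<omega> \<in> space M. \<forall>k\<le>n. Z k \<omega> = z k \<and> S k \<omega> > 0} \<omega> * f (S n \<omega>) \<partial>M) =
        ennreal (\<Prod>k<n. jump_prob q (z k) (z (Suc k))) * h (z n)"
  shows "z 0 = x \<Longrightarrow>
    (\<integral>\<^sup>+\<omega>. indicator {\<omega> \<in> space M. (\<forall>k\<le>n. Z k \<omega> = z k) \<and> (\<forall>k\<le>n + m. S k \<omega> > 0) \<and>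
        (\<forall>k\<in>{n<..n + m}. Z k \<omega> \<in> A)} \<omega> * f (S (n + m) \<omega>) \<partial>M) =
      ennreal (\<Prod>k<n. jump_prob q (z k) (z (Suc k))) * (killed_step q A ^^ m) h (z n)"
proof (induction m arbitrary: n z)
  case 0
  have "{\<omega> \<in> space M. (\<forall>k\<le>n. Z k \<omega> = z k) \<and> (\<forall>k\<le>n + 0. S k \<omega> > 0) \<and>
        (\<forall>k\<in>{n<..n + 0}. Z k \<omega> \<in> A)} = {\<omega> \<in> space M. \<forall>k\<le>n. Z k \<omega> = z k \<and> S k \<omega> > 0}"
    by auto
  then show ?case using base[where z = z and n = n] 0 by simp
next
  case (Suc m)
  define E where "E n m z = {\<omega> \<in> space M. (\<forall>k\<le>n. Z k \<omega> = z k) \<and> (\<forall>k\<le>n + m. S k \<omega> > 0) \<and>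
        (\<forall>k\<in>{n<..n + m}. Z k \<omega> \<in> A)}" for n m z
  have Zw: "{\<omega> \<in> space M. Z k \<omega> = w} \<in> sets M" for k w
    by (rule measurable_sets_Collect[OF Z]) simp
  have ZA: "{\<omega> \<in> space M. Z k \<omega> \<in> A} \<in> sets M" for k
    by (rule measurable_sets_Collect[OF Z]) simp
  have Sp: "{\<omega> \<in> space M. S k \<omega> > 0} \<in> sets M" for k
    by measurable
  have E[measurable]: "E n m z \<in> sets M" for n m z
    unfolding E_def Ball_def
    by (intro sets.sets_Collect sets.sets_Collect_countable_All Zw ZA Sp)
  let ?z = "\<lambda>w. z(Suc n := w)"
  have split: "indicator (E n (Suc m) z) \<omega> =
      (\<integral>\<^sup>+w. indicator A w * indicator (E (Suc n) m (?z w)) \<omega> \<partial>count_space UNIV)"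
    if "\<omega> \<in> space M" for \<omega>
  proof -
    have only: "indicator A w * indicator (E (Suc n) m (?z w)) \<omega> = (0 :: ennreal)"
      if "w \<noteq> Z (Suc n) \<omega>" for w
      using that unfolding E_def by (auto split: split_indicator)
    have "(\<integral>\<^sup>+w. indicator A w * indicator (E (Suc n) m (?z w)) \<omega> \<partial>count_space UNIV) =
        (\<Sum>w\<in>{Z (Suc n) \<omega>}. indicator A w * indicator (E (Suc n) m (?z w)) \<omega> :: ennreal)"
      by (rule nn_integral_count_space') (simp_all only: only singleton_iff finite.intros subset_UNIV not_False_eq_True)
    also have "\<dots> = indicator A (Z (Suc n) \<omega>) * indicator (E (Suc n) m (?z (Z (Suc n) \<omega>))) \<omega>"
      by (simp only: sum.insert finite.emptyI empty_iff not_False_eq_True sum.empty add_0_right)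
    also have "\<dots> = indicator (E n (Suc m) z) \<omega>"
    proof -
      have "(\<forall>k\<le>Suc n. Z k \<omega> = ?z (Z (Suc n) \<omega>) k) \<longleftrightarrow> (\<forall>k\<le>n. Z k \<omega> = z k)"
        by (auto simp: le_Suc_eq)
      moreover have "(\<forall>k\<in>{n<..n + Suc m}. Z k \<omega> \<in> A) \<longleftrightarrow>
          Z (Suc n) \<omega> \<in> A \<and> (\<forall>k\<in>{Suc n<..Suc n + m}. Z k \<omega> \<in> A)"
      proof -
        have "{n<..n + Suc m} = insert (Suc n) {Suc n<..Suc n + m}" by auto
        then show ?thesis by simp
      qed
      ultimately show ?thesis
        using that unfolding E_def by (auto split: split_indicator)
    qed
    finally show ?thesis by simp
  qed
  \<comment> \<open>Exchange the sum over the next state with the expectation and extend the prescribed path by it.\<close>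
  have "(\<integral>\<^sup>+\<omega>. indicator (E n (Suc m) z) \<omega> * f (S (n + Suc m) \<omega>) \<partial>M) =
      (\<integral>\<^sup>+\<omega>. (\<integral>\<^sup>+w. indicator A w * indicator (E (Suc n) m (?z w)) \<omega> * f (S (n + Suc m) \<omega>)
        \<partial>count_space UNIV) \<partial>M)"
    by (intro nn_integral_cong) (simp add: split nn_integral_multc)
  also have "\<dots> = (\<integral>\<^sup>+w. (\<integral>\<^sup>+\<omega>. indicator A w * indicator (E (Suc n) m (?z w)) \<omega> *
      f (S (n + Suc m) \<omega>) \<partial>M) \<partial>count_space UNIV)"
    by (rule nn_integral_count_space_nn_integral) auto
  also have "\<dots> = (\<integral>\<^sup>+w. ennreal (\<Prod>k<n. jump_prob q (z k) (z (Suc k))) *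
      (ennreal (jump_prob q (z n) w) * indicator A w * (killed_step q A ^^ m) h w)
      \<partial>count_space UNIV)"
  proof (intro nn_integral_cong)
    fix w
    have "(\<integral>\<^sup>+\<omega>. indicator A w * indicator (E (Suc n) m (?z w)) \<omega> * f (S (n + Suc m) \<omega>) \<partial>M) =
        indicator A w * (\<integral>\<^sup>+\<omega>. indicator (E (Suc n) m (?z w)) \<omega> * f (S (Suc n + m) \<omega>) \<partial>M)"
      by (subst nn_integral_cmult[symmetric]) (auto simp: mult.assoc)
    also have "\<dots> = indicator A w * (ennreal (\<Prod>k<Suc n. jump_prob q (?z w k) (?z w (Suc k))) *
        (killed_step q A ^^ m) h w)"
      using Suc.IH[of "?z w" "Suc n"] Suc.prems unfolding E_def by simp
    also have "(\<Prod>k<Suc n. jump_prob q (?z w k) (?z w (Suc k))) =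
        (\<Prod>k<n. jump_prob q (z k) (z (Suc k))) * jump_prob q (z n) w"
      by simp
    finally show "(\<integral>\<^sup>+\<omega>. indicator A w * indicator (E (Suc n) m (?z w)) \<omega> *
        f (S (n + Suc m) \<omega>) \<partial>M) = ennreal (\<Prod>k<n. jump_prob q (z k) (z (Suc k))) *
        (ennreal (jump_prob q (z n) w) * indicator A w * (killed_step q A ^^ m) h w)"
      by (simp add: ennreal_mult p prod_nonneg ac_simps fun_upd_def)
  qed
  also have "\<dots> = ennreal (\<Prod>k<n. jump_prob q (z k) (z (Suc k))) *
      (killed_step q A ^^ Suc m) h (z n)"
    by (subst nn_integral_cmult) (auto simp: killed_step_def)
  finally show ?case unfolding E_def .
qed

lemma nn_integral_exp_decay:
  assumes "c > 0"
  shows "(\<integral>\<^sup>+t. ennreal (exp (- c * t)) * indicator {0..} t \<partial>lborel) = ennreal (1 / c)"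
proof -
  have "filterlim (\<lambda>t. - c * t) at_bot at_top"
    using assms by (intro filterlim_tendsto_neg_mult_at_bot[OF tendsto_const]) (auto intro: filterlim_ident)
  then have "((\<lambda>t. exp (- c * t)) \<longlongrightarrow> 0) at_top"
    by (rule filterlim_compose[OF exp_at_bot])
  then have "((\<lambda>t. - exp (- c * t) / c) \<longlongrightarrow> - 0 / c) at_top"
    using assms by (intro tendsto_intros) auto
  then have "(\<integral>\<^sup>+t. ennreal (exp (- c * t)) * indicator {0..} t \<partial>lborel) =
      ennreal (- 0 / c - (- exp (- c * 0) / c))"
    using assms by (intro nn_integral_FTC_atLeast)
      (auto intro!: derivative_eq_intros)
  then show ?thesis by simp
qed

text \<open>
  The joint law is known through tail probabilities of the holding times, so their expectations
  are read off by integrating tails.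
\<close>

lemma nn_integral_eq_tail:
  assumes "prob_space M" and E[measurable]: "E \<in> sets M" and X[measurable]: "X \<in> borel_measurable M"
  shows "(\<integral>\<^sup>+\<omega>. indicator E \<omega> * ennreal (X \<omega>) \<partial>M) =
    (\<integral>\<^sup>+t. emeasure M {\<omega> \<in> E. X \<omega> > t} * indicator {0..} t \<partial>lborel)"
proof -
  interpret prob_space M by fact
  interpret pair_sigma_finite lborel M by unfold_locales
  have EM: "E \<subseteq> space M" using E by (rule sets.sets_into_space)
  have "(\<integral>\<^sup>+\<omega>. indicator E \<omega> * ennreal (X \<omega>) \<partial>M) =
      (\<integral>\<^sup>+\<omega>. (\<integral>\<^sup>+t. indicator E \<omega> * indicator {0..<X \<omega>} t \<partial>lborel) \<partial>M)"
  proof (intro nn_integral_cong)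
    fix \<omega>
    show "indicator E \<omega> * ennreal (X \<omega>) = (\<integral>\<^sup>+t. indicator E \<omega> * indicator {0..<X \<omega>} t \<partial>lborel)"
      by (cases "0 \<le> X \<omega>") (auto simp: nn_integral_cmult ennreal_neg)
  qed
  also have "\<dots> = (\<integral>\<^sup>+\<omega>. (\<integral>\<^sup>+t. indicator E \<omega> * (if 0 \<le> t \<and> t < X \<omega> then 1 else 0) \<partial>lborel) \<partial>M)"
    by (intro nn_integral_cong) (auto split: split_indicator)
  also have "\<dots> = (\<integral>\<^sup>+t. (\<integral>\<^sup>+\<omega>. indicator E \<omega> * (if 0 \<le> t \<and> t < X \<omega> then 1 else 0) \<partial>M) \<partial>lborel)"
    by (rule Fubini') measurable
  also have "\<dots> = (\<integral>\<^sup>+t. (\<integral>\<^sup>+\<omega>. indicator {\<omega> \<in> E. X \<omega> > t} \<omega> * indicator {0..} t \<partial>M) \<partial>lborel)"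
    by (intro nn_integral_cong) (auto split: split_indicator)
  also have "\<dots> = (\<integral>\<^sup>+t. emeasure M {\<omega> \<in> E. X \<omega> > t} * indicator {0..} t \<partial>lborel)"
  proof -
    have "{\<omega> \<in> E. X \<omega> > t} \<in> sets M" for t
    proof -
      have "{\<omega> \<in> E. X \<omega> > t} = E \<inter> {\<omega> \<in> space M. X \<omega> > t}" using EM by auto
      then show ?thesis by simp
    qed
    then show ?thesis
      by (intro nn_integral_cong) (simp add: nn_integral_multc)
  qed
  finally show ?thesis .
qed

section \<open>Mean return times as path sums\<close>

text \<open>
  The process is back in \<open>x\<close> no earlier than the jump chain. The bound is on partial sums, so
  it also covers a path that never returns, without any statement about explosion: a time \<open>t\<close>
  with \<open>Y t = x\<close> cannot lie in a holding interval of another state, and not in the first one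
  since \<open>Y\<close> has to have left \<open>x\<close> before \<open>t\<close>.
\<close>

lemma sum_le_return_time:
  assumes S: "\<And>k. S k > (0::real)" and Z0: "Z 0 = x"
    and Y: "\<And>n t. (\<Sum>k<n. S k) \<le> t \<Longrightarrow> t < (\<Sum>k<Suc n. S k) \<Longrightarrow> Y t \<omega> = Z n"
  shows "(\<Sum>k. ennreal (S k) * of_bool (\<forall>i\<in>{0<..k}. Z i \<noteq> x)) \<le> return_time Y x \<omega>"
  unfolding return_time_def
proof (rule INF_greatest, clarify)
  fix t u :: real
  assume t: "0 \<le> t" "x = Y t \<omega>" and u: "0 \<le> u" "u < t" "Y u \<omega> \<noteq> Y t \<omega>"
  have passed: "(\<Sum>k<n. S k) \<le> t" if "n = 0 \<or> (\<forall>i\<in>{0<..n - 1}. Z i \<noteq> x)" for n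
    using that
  proof (induction n)
    case 0
    then show ?case using t by simp
  next
    case (Suc n)
    then have all: "\<forall>i\<in>{0<..n}. Z i \<noteq> x" by simp
    then have "n = 0 \<or> (\<forall>i\<in>{0<..n - 1}. Z i \<noteq> x)" by auto
    then have le: "(\<Sum>k<n. S k) \<le> t" by (rule Suc.IH)
    show ?case
    proof (rule ccontr)
      assume "\<not> (\<Sum>k<Suc n. S k) \<le> t"
      then have lt: "t < (\<Sum>k<Suc n. S k)" by simp
      from Y[OF le lt] t(2) have "Z n = x" by simp
      with all have "n = 0" by auto
      with lt u have "Y u \<omega> = Z 0" by (intro Y) auto
      with Z0 t(2) u(3) show False by simp
    qed
  qed
  have "(\<Sum>k<n. ennreal (S k) * of_bool (\<forall>i\<in>{0<..k}. Z i \<noteq> x)) \<le> ennreal t" for n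
  proof (induction n)
    case (Suc n)
    show ?case
    proof (cases "\<forall>i\<in>{0<..n}. Z i \<noteq> x")
      case True
      have "(\<Sum>k<Suc n. ennreal (S k) * of_bool (\<forall>i\<in>{0<..k}. Z i \<noteq> x)) =
          (\<Sum>k<Suc n. ennreal (S k))"
        using True by (intro sum.cong) auto
      also have "\<dots> = ennreal (\<Sum>k<Suc n. S k)"
        using S by (intro sum_ennreal) (auto intro: less_imp_le)
      also have "\<dots> \<le> ennreal t"
        using passed[of "Suc n"] True by (intro ennreal_leI) simp
      finally show ?thesis .
    next
      case False
      then have "of_bool (\<forall>i\<in>{0<..n}. Z i \<noteq> x) = (0::ennreal)" by simp
      with Suc show ?thesis unfolding sum.lessThan_Suc by (simp only: mult_zero_right add_0_right)
    qed
  qed simp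
  then show "(\<Sum>k. ennreal (S k) * of_bool (\<forall>i\<in>{0<..k}. Z i \<noteq> Y t \<omega>)) \<le> ennreal t"
    unfolding t(2)[symmetric] by (intro suminf_le_const) auto
qed

text \<open>
  When the jump chain does come back, the process is in \<open>x\<close> at that jump, and it was elsewhere at
  the first jump. The hypothesis \<open>Z 1 \<noteq> x\<close> excludes a fictitious jump from \<open>x\<close> to itself.
\<close>

lemma return_time_le_sum:
  assumes S: "\<And>k. S k > (0::real)" and Z1: "Z 1 \<noteq> x" and ret: "\<exists>k>0. Z k = x"
    and Y: "\<And>n t. (\<Sum>k<n. S k) \<le> t \<Longrightarrow> t < (\<Sum>k<Suc n. S k) \<Longrightarrow> Y t \<omega> = Z n"
  shows "return_time Y x \<omega> \<le> (\<Sum>k. ennreal (S k) * of_bool (\<forall>i\<in>{0<..k}. Z i \<noteq> x))"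
proof -
  define n where "n = (LEAST k. k > 0 \<and> Z k = x)"
  have n: "n > 0" "Z n = x"
    using LeastI_ex[OF ret] unfolding n_def by auto
  have min: "Z k \<noteq> x" if "k > 0" "k < n" for k
    using not_less_Least[of k "\<lambda>k. k > 0 \<and> Z k = x"] that unfolding n_def by auto
  have "n \<noteq> 1" using Z1 n by auto
  with n have "n > 1" by simp
  define t where "t = (\<Sum>k<n. S k)"
  have "S 0 < t"
  proof -
    have "(\<Sum>k<1. S k) < (\<Sum>k<n. S k)"
      using \<open>n > 1\<close> S by (intro sum_strict_mono2[of _ _ 1]) (auto intro: less_imp_le)
    then show ?thesis by (simp add: t_def)
  qed
  moreover have "Y (S 0) \<omega> = Z 1"
    using S[of 1] by (intro Y) auto
  moreover have "Y t \<omega> = x"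
    using S[of n] n(2) Y[of n t] by (simp add: t_def)
  ultimately have "t \<in> {t. 0 \<le> t \<and> Y t \<omega> = x \<and> (\<exists>s. 0 \<le> s \<and> s < t \<and> Y s \<omega> \<noteq> x)}"
    using S[of 0] Z1 by (auto intro!: exI[of _ "S 0"])
  then have "return_time Y x \<omega> \<le> ennreal t"
    unfolding return_time_def by (rule INF_lower)
  also have "ennreal t = (\<Sum>k<n. ennreal (S k))"
    unfolding t_def using S by (intro sum_ennreal[symmetric]) (auto intro: less_imp_le)
  also have "\<dots> = (\<Sum>k<n. ennreal (S k) * of_bool (\<forall>i\<in>{0<..k}. Z i \<noteq> x))"
  proof (intro sum.cong refl)
    fix k assume "k \<in> {..<n}"
    then have "\<forall>i\<in>{0<..k}. Z i \<noteq> x" using min by auto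
    then show "ennreal (S k) = ennreal (S k) * of_bool (\<forall>i\<in>{0<..k}. Z i \<noteq> x)" by simp
  qed
  also have "\<dots> \<le> (\<Sum>k. ennreal (S k) * of_bool (\<forall>i\<in>{0<..k}. Z i \<noteq> x))"
    by (rule sum_le_suminf) auto
  finally show ?thesis .
qed

text \<open>
  Rates bounded away from zero and exit rates bounded above: holding times then have comparable
  means everywhere, and every possible jump has a uniformly positive probability.
\<close>

locale bounded_rates =
  fixes q :: "'s::countable \<Rightarrow> 's \<Rightarrow> real" and r R :: real
  assumes r_pos: "r > 0"
    and rate_nonneg: "q y z \<ge> 0"
    and rate_ge: "z \<noteq> y \<Longrightarrow> q y z \<noteq> 0 \<Longrightarrow> q y z \<ge> r"
    and finite_succ: "finite {z. z \<noteq> y \<and> q y z \<noteq> 0}"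
    and exit_pos: "exit_rate q y > 0"
    and exit_le: "exit_rate q y \<le> R"
begin

abbreviation "succ y \<equiv> {z. z \<noteq> y \<and> q y z \<noteq> 0}"

lemma exit_rate_eq: "exit_rate q y = (\<Sum>z\<in>succ y. q y z)"
proof -
  have "exit_rate q y = infsum (q y) (succ y)"
    unfolding exit_rate_def by (rule infsum_cong_neutral) auto
  then show ?thesis using finite_succ by simp
qed

lemma jump_prob_nonneg: "jump_prob q y z \<ge> 0"
  using exit_pos[of y] rate_nonneg by (auto simp: jump_prob_def)

lemma killed_step_eq_sum:
  "killed_step q A h y = (\<Sum>z\<in>succ y. ennreal (q y z / exit_rate q y) * indicator A z * h z)"
  unfolding killed_step_def using finite_succ
  by (subst nn_integral_count_space'[where A = "succ y"]) (auto simp: jump_prob_def intro!: sum.cong)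

lemma killed_step_UNIV_one: "killed_step q UNIV (\<lambda>_. 1) y = 1"
proof -
  have "killed_step q UNIV (\<lambda>_. 1) y = ennreal (\<Sum>z\<in>succ y. q y z / exit_rate q y)"
    unfolding killed_step_eq_sum using rate_nonneg exit_pos[of y]
    by (simp add: sum_ennreal less_imp_le)
  also have "(\<Sum>z\<in>succ y. q y z / exit_rate q y) = 1"
    using exit_pos[of y] by (simp add: sum_divide_distrib[symmetric] exit_rate_eq[symmetric])
  finally show ?thesis by simp
qed

abbreviation mean_hold :: "'s \<Rightarrow> ennreal" where
  "mean_hold y \<equiv> ennreal (1 / exit_rate q y)"

context
  fixes M :: "'w measure" and x :: 's and Z :: "nat \<Rightarrow> 'w \<Rightarrow> 's" and S :: "nat \<Rightarrow> 'w \<Rightarrow> real"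
  assumes M: "prob_space M" and law: "jump_hold_law M q x Z S"
begin

lemma Z_measurable[measurable]: "Z n \<in> measurable M (count_space UNIV)"
  and S_measurable[measurable]: "S n \<in> borel_measurable M"
  using law unfolding jump_hold_law_def by auto

lemma prefix_sets: "{\<omega> \<in> space M. \<forall>k\<le>n. Z k \<omega> = z k \<and> S k \<omega> > t k} \<in> sets M"
proof -
  have 1: "{\<omega> \<in> space M. Z k \<omega> = z k} \<in> sets M" for k
    by (rule measurable_sets_Collect[OF Z_measurable]) simp
  have 2: "{\<omega> \<in> space M. S k \<omega> > t k} \<in> sets M" for k
    by measurable
  show ?thesis
    by (intro sets.sets_Collect sets.sets_Collect_countable_All 1 2)
qed

lemma emeasure_prefix:
  assumes "z 0 = x" "0 \<le> t"
  shows "emeasure M {\<omega> \<in> space M. (\<forall>k\<le>n. Z k \<omega> = z k \<and> S k \<omega> > 0) \<and> S n \<omega> > t} =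
    ennreal (\<Prod>k<n. jump_prob q (z k) (z (Suc k))) * ennreal (exp (- exit_rate q (z n) * t))"
proof -
  interpret prob_space M by (rule M)
  let ?t = "\<lambda>k. if k = n then t else 0"
  have "{\<omega> \<in> space M. (\<forall>k\<le>n. Z k \<omega> = z k \<and> S k \<omega> > 0) \<and> S n \<omega> > t} =
      {\<omega> \<in> space M. \<forall>k\<le>n. Z k \<omega> = z k \<and> S k \<omega> > ?t k}"
  proof (intro Collect_cong conj_cong refl iffI)
    fix \<omega>
    assume "(\<forall>k\<le>n. Z k \<omega> = z k \<and> S k \<omega> > 0) \<and> S n \<omega> > t"
    then show "\<forall>k\<le>n. Z k \<omega> = z k \<and> S k \<omega> > ?t k" by simp
  next
    fix \<omega>
    assume *: "\<forall>k\<le>n. Z k \<omega> = z k \<and> S k \<omega> > ?t k"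
    have "S k \<omega> > 0" if "k \<le> n" for k
    proof -
      have "0 \<le> ?t k" using \<open>0 \<le> t\<close> by simp
      also have "?t k < S k \<omega>" using * that by blast
      finally show ?thesis .
    qed
    moreover have "S n \<omega> > t" using * by (elim allE[of _ n]) simp
    ultimately show "(\<forall>k\<le>n. Z k \<omega> = z k \<and> S k \<omega> > 0) \<and> S n \<omega> > t"
      using * by blast
  qed
  moreover have "(\<Prod>k\<le>n. exp (- exit_rate q (z k) * ?t k)) = exp (- exit_rate q (z n) * t)"
  proof -
    have "(\<Prod>k\<le>n. exp (- exit_rate q (z k) * ?t k)) =
        (\<Prod>k\<le>n. if k = n then exp (- exit_rate q (z n) * t) else 1)"
      by (intro prod.cong) auto
    then show ?thesis by simp
  qed
  moreover have "measure M {\<omega> \<in> space M. \<forall>k\<le>n. Z k \<omega> = z k \<and> S k \<omega> > ?t k} =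
      of_bool (z 0 = x) * (\<Prod>k<n. jump_prob q (z k) (z (Suc k)))
            * (\<Prod>k\<le>n. exp (- exit_rate q (z k) * ?t k))"
    using law \<open>0 \<le> t\<close> unfolding jump_hold_law_def by simp
  ultimately show ?thesis
    using assms by (simp add: emeasure_eq_measure ennreal_mult jump_prob_nonneg prod_nonneg)
qed

lemma prefix_one:
  assumes "z 0 = x"
  shows "(\<integral>\<^sup>+\<omega>. indicator {\<omega> \<in> space M. \<forall>k\<le>n. Z k \<omega> = z k \<and> S k \<omega> > 0} \<omega> * 1 \<partial>M) =
    ennreal (\<Prod>k<n. jump_prob q (z k) (z (Suc k))) * 1"
proof -
  have "{\<omega> \<in> space M. \<forall>k\<le>n. Z k \<omega> = z k \<and> S k \<omega> > 0} =
      {\<omega> \<in> space M. (\<forall>k\<le>n. Z k \<omega> = z k \<and> S k \<omega> > 0) \<and> S n \<omega> > 0}"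
    by auto
  then have "emeasure M {\<omega> \<in> space M. \<forall>k\<le>n. Z k \<omega> = z k \<and> S k \<omega> > 0} =
      ennreal (\<Prod>k<n. jump_prob q (z k) (z (Suc k)))"
    using emeasure_prefix[where z = z and t = 0 and n = n] assms by simp
  then show ?thesis
    by (simp only: mult_1_right nn_integral_indicator[OF prefix_sets[where t = "\<lambda>_. 0"]])
qed

lemma prefix_hold:
  assumes "z 0 = x"
  shows "(\<integral>\<^sup>+\<omega>. indicator {\<omega> \<in> space M. \<forall>k\<le>n. Z k \<omega> = z k \<and> S k \<omega> > 0} \<omega> * ennreal (S n \<omega>) \<partial>M) =
    ennreal (\<Prod>k<n. jump_prob q (z k) (z (Suc k))) * mean_hold (z n)"
proof -
  let ?E = "{\<omega> \<in> space M. \<forall>k\<le>n. Z k \<omega> = z k \<and> S k \<omega> > 0}"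
  let ?p = "\<Prod>k<n. jump_prob q (z k) (z (Suc k))"
  have "(\<integral>\<^sup>+\<omega>. indicator ?E \<omega> * ennreal (S n \<omega>) \<partial>M) =
      (\<integral>\<^sup>+t. emeasure M {\<omega> \<in> ?E. S n \<omega> > t} * indicator {0..} t \<partial>lborel)"
    by (intro nn_integral_eq_tail M prefix_sets S_measurable)
  also have "\<dots> = (\<integral>\<^sup>+t. ennreal ?p * (ennreal (exp (- exit_rate q (z n) * t)) *
      indicator {0..} t) \<partial>lborel)"
  proof (intro nn_integral_cong)
    fix t :: real
    have "{\<omega> \<in> ?E. S n \<omega> > t} =
        {\<omega> \<in> space M. (\<forall>k\<le>n. Z k \<omega> = z k \<and> S k \<omega> > 0) \<and> S n \<omega> > t}" by auto
    then show "emeasure M {\<omega> \<in> ?E. S n \<omega> > t} * indicator {0..} t =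
        ennreal ?p * (ennreal (exp (- exit_rate q (z n) * t)) * indicator {0..} t)"
      using emeasure_prefix[where z = z and t = t and n = n] assms by (auto split: split_indicator)
  qed
  also have "\<dots> = ennreal ?p * mean_hold (z n)"
    using nn_integral_exp_decay[OF exit_pos[of "z n"]] by (subst nn_integral_cmult) auto
  finally show ?thesis .
qed

abbreviation avoid :: "'s set \<Rightarrow> nat \<Rightarrow> 'w set" where
  "avoid A m \<equiv> {\<omega> \<in> space M. Z 0 \<omega> = x \<and> (\<forall>k\<le>m. S k \<omega> > 0) \<and> (\<forall>k\<in>{0<..m}. Z k \<omega> \<in> A)}"

lemma avoid_sets: "avoid A m \<in> sets M"
proof -
  have 1: "{\<omega> \<in> space M. Z k \<omega> = w} \<in> sets M" "{\<omega> \<in> space M. Z k \<omega> \<in> A} \<in> sets M" for k w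
    by (rule measurable_sets_Collect[OF Z_measurable], simp)+
  have 2: "{\<omega> \<in> space M. S k \<omega> > 0} \<in> sets M" for k
    by measurable
  show ?thesis
    unfolding Ball_def by (intro sets.sets_Collect sets.sets_Collect_countable_All 1 2)
qed

lemma emeasure_avoid: "emeasure M (avoid A m) = (killed_step q A ^^ m) (\<lambda>_. 1) x"
proof -
  have "(\<integral>\<^sup>+\<omega>. indicator {\<omega> \<in> space M. (\<forall>k\<le>0. Z k \<omega> = x) \<and> (\<forall>k\<le>0 + m. S k \<omega> > 0) \<and>
      (\<forall>k\<in>{0<..0 + m}. Z k \<omega> \<in> A)} \<omega> * 1 \<partial>M) =
    ennreal (\<Prod>k<(0::nat). jump_prob q x x) * (killed_step q A ^^ m) (\<lambda>_. 1) x"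
  proof (rule path_integral[where x = x and z = "\<lambda>_. x" and n = 0 and f = "\<lambda>_. 1" and h = "(\<lambda>_. 1)"])
    fix n and z :: "nat \<Rightarrow> 's"
    assume "z 0 = x"
    then show "(\<integral>\<^sup>+\<omega>. indicator {\<omega> \<in> space M. \<forall>k\<le>n. Z k \<omega> = z k \<and> S k \<omega> > 0} \<omega> * 1 \<partial>M) =
        ennreal (\<Prod>k<n. jump_prob q (z k) (z (Suc k))) * 1"
      by (rule prefix_one[where z = z and n = n])
  qed (rule Z_measurable S_measurable jump_prob_nonneg refl borel_measurable_const measurable_ennreal)+
  then have "(\<integral>\<^sup>+\<omega>. indicator (avoid A m) \<omega> \<partial>M) = (killed_step q A ^^ m) (\<lambda>_. 1) x"
    by (simp only: le_zero_eq simp_thms add_0 lessThan_0 prod.empty mult_1_right mult_1_left ennreal_1)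
  then show ?thesis
    by (simp only: nn_integral_indicator[OF avoid_sets])
qed

lemma hold_avoid:
  "(\<integral>\<^sup>+\<omega>. indicator (avoid A m) \<omega> * ennreal (S m \<omega>) \<partial>M) = (killed_step q A ^^ m) mean_hold x"
proof -
  have "(\<integral>\<^sup>+\<omega>. indicator {\<omega> \<in> space M. (\<forall>k\<le>0. Z k \<omega> = x) \<and> (\<forall>k\<le>0 + m. S k \<omega> > 0) \<and>
      (\<forall>k\<in>{0<..0 + m}. Z k \<omega> \<in> A)} \<omega> * ennreal (S (0 + m) \<omega>) \<partial>M) =
    ennreal (\<Prod>k<(0::nat). jump_prob q x x) * (killed_step q A ^^ m) mean_hold x"
  proof (rule path_integral[where x = x and z = "\<lambda>_. x" and n = 0 and f = "ennreal" and h = "mean_hold"])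
    fix n and z :: "nat \<Rightarrow> 's"
    assume "z 0 = x"
    then show "(\<integral>\<^sup>+\<omega>. indicator {\<omega> \<in> space M. \<forall>k\<le>n. Z k \<omega> = z k \<and> S k \<omega> > 0} \<omega> * ennreal (S n \<omega>) \<partial>M) =
        ennreal (\<Prod>k<n. jump_prob q (z k) (z (Suc k))) * mean_hold (z n)"
      by (rule prefix_hold[where z = z and n = n])
  qed (rule Z_measurable S_measurable jump_prob_nonneg refl borel_measurable_const measurable_ennreal)+
  then show ?thesis
    by (simp only: le_zero_eq simp_thms add_0 lessThan_0 prod.empty mult_1_right mult_1_left ennreal_1)
qed

text \<open>
  Each cylinder with positive holding times carries the full probability of its path, and the
  path probabilities of a stochastic kernel add up to one; hence all holding times are almost
  surely positive. A jump from \<open>x\<close> to itself has probability \<open>jump_prob q x x = 0\<close>.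
\<close>

lemma AE_regular: "AE \<omega> in M. Z 0 \<omega> = x \<and> Z 1 \<omega> \<noteq> x \<and> (\<forall>k. S k \<omega> > 0)"
proof -
  interpret prob_space M by (rule M)
  have "(killed_step q UNIV ^^ m) (\<lambda>_. 1) = (\<lambda>_. 1)" for m
    by (induction m) (auto simp: killed_step_UNIV_one)
  then have "AE \<omega> in M. \<omega> \<in> avoid UNIV m" for m
    using emeasure_avoid[where A = UNIV and m = m]
    by (subst AE_in_set_eq_1[OF avoid_sets]) (simp only: emeasure_eq_measure ennreal_eq_1)
  then have "AE \<omega> in M. \<forall>m. \<omega> \<in> avoid UNIV m"
    by (subst AE_all_countable) auto
  moreover have "AE \<omega> in M. \<omega> \<notin> avoid {x} 1"
  proof -
    have "killed_step q {x} (\<lambda>_. 1) x = 0"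
      unfolding killed_step_eq_sum by (intro sum.neutral) auto
    then show ?thesis
      using emeasure_avoid[where A = "{x}" and m = 1]
      by (intro AE_not_in null_setsI avoid_sets) (simp only: One_nat_def funpow.simps o_apply id_apply)
  qed
  ultimately show ?thesis
  proof eventually_elim
    case (elim \<omega>)
    then have "\<omega> \<in> space M" "Z 0 \<omega> = x" "\<And>k. S k \<omega> > 0" by auto
    moreover have "Z 1 \<omega> \<noteq> x"
    proof
      assume "Z 1 \<omega> = x"
      moreover have "{0<..1::nat} = {1}" by auto
      ultimately have "\<omega> \<in> avoid {x} 1"
        using \<open>\<omega> \<in> space M\<close> \<open>Z 0 \<omega> = x\<close> \<open>\<And>k. S k \<omega> > 0\<close> by simp
      with elim(2) show False ..
    qed
    ultimately show ?case by auto
  qed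
qed

lemma nn_integral_excursion:
  "(\<integral>\<^sup>+\<omega>. (\<Sum>k. ennreal (S k \<omega>) * of_bool (\<forall>i\<in>{0<..k}. Z i \<omega> \<noteq> x)) \<partial>M) =
    (\<Sum>k. (killed_step q (- {x}) ^^ k) mean_hold x)"
proof -
  have "(\<integral>\<^sup>+\<omega>. (\<Sum>k. ennreal (S k \<omega>) * of_bool (\<forall>i\<in>{0<..k}. Z i \<omega> \<noteq> x)) \<partial>M) =
      (\<integral>\<^sup>+\<omega>. (\<Sum>k. indicator (avoid (- {x}) k) \<omega> * ennreal (S k \<omega>)) \<partial>M)"
  proof (rule nn_integral_cong_AE, use AE_regular AE_space in eventually_elim)
    case (elim \<omega>)
    then have "\<omega> \<in> avoid (- {x}) k \<longleftrightarrow> (\<forall>i\<in>{0<..k}. Z i \<omega> \<noteq> x)" for k by auto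
    then show ?case by (simp add: indicator_def of_bool_def mult.commute)
  qed
  also have "\<dots> = (\<Sum>k. \<integral>\<^sup>+\<omega>. indicator (avoid (- {x}) k) \<omega> * ennreal (S k \<omega>) \<partial>M)"
    by (intro nn_integral_suminf borel_measurable_times_ennreal borel_measurable_indicator avoid_sets
      measurable_compose[OF S_measurable measurable_ennreal])
  finally show ?thesis by (simp only: hold_avoid)
qed

text \<open>
  A finite mean forces recurrence: mean holding times are at least \<open>1 / R\<close>, so the probabilities
  of not having returned after \<open>k\<close> jumps are summable, and Borel--Cantelli applies.
\<close>

lemma AE_returns:
  assumes "(\<Sum>k. (killed_step q (- {x}) ^^ k) mean_hold x) < \<infinity>"
  shows "AE \<omega> in M. \<exists>k>0. Z k \<omega> = x"
proof -
  interpret prob_space M by (rule M)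
  have R: "R > 0" using exit_pos[of x] exit_le[of x] by linarith
  have "1 \<le> ennreal R * mean_hold y" for y
  proof -
    have "1 \<le> R * (1 / exit_rate q y)" using exit_pos[of y] exit_le[of y] by (simp add: field_simps)
    then have "ennreal 1 \<le> ennreal (R * (1 / exit_rate q y))" by (rule ennreal_leI)
    then show ?thesis using R exit_pos[of y] by (simp add: ennreal_mult[symmetric] less_imp_le)
  qed
  then have le: "(killed_step q (- {x}) ^^ k) (\<lambda>_. 1) y \<le> ennreal R * (killed_step q (- {x}) ^^ k) mean_hold y"
    for k y
  proof (induction k arbitrary: y)
    case (Suc k)
    have "killed_step q (- {x}) ((killed_step q (- {x}) ^^ k) (\<lambda>_. 1)) y \<le>
        killed_step q (- {x}) (\<lambda>y. ennreal R * (killed_step q (- {x}) ^^ k) mean_hold y) y"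
      using Suc by (intro killed_step_mono) auto
    then show ?case by (simp add: killed_step_cmult)
  qed simp
  have "(\<Sum>k. ennreal (measure M (avoid (- {x}) k))) \<le>
      (\<Sum>k. ennreal R * (killed_step q (- {x}) ^^ k) mean_hold x)"
    unfolding emeasure_eq_measure[symmetric] emeasure_avoid by (intro suminf_le le) auto
  also have "\<dots> < \<infinity>" using assms by (simp add: ennreal_mult_less_top)
  finally have "summable (\<lambda>k. measure M (avoid (- {x}) k))"
    by (intro summable_suminf_not_top) auto
  then have "AE \<omega> in M. eventually (\<lambda>k. \<omega> \<in> space M - avoid (- {x}) k) sequentially"
    by (intro borel_cantelli_AE1 avoid_sets) (auto simp: emeasure_eq_measure)
  with AE_regular show ?thesis
  proof eventually_elim
    case (elim \<omega>)
    then obtain k where "\<omega> \<in> space M - avoid (- {x}) k"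
      unfolding eventually_sequentially by blast
    with elim show ?case by auto
  qed
qed

end

text \<open>
  The continuous-time question becomes one about the kernel. Only the upper bound needs the
  jump chain to return, and it is used only when the path sum is finite, which entails this.
\<close>

theorem return_time_finite_iff:
  assumes "ctmc_from M q x Y"
  shows "(\<integral>\<^sup>+\<omega>. return_time Y x \<omega> \<partial>M) < \<infinity> \<longleftrightarrow>
    (\<Sum>k. (killed_step q (- {x}) ^^ k) mean_hold x) < \<infinity>"
proof -
  obtain Z S where M: "prob_space M" and law: "jump_hold_law M q x Z S" and
    Y: "AE \<omega> in M. \<forall>n t. (\<Sum>k<n. S k \<omega>) \<le> t \<and> t < (\<Sum>k<Suc n. S k \<omega>) \<longrightarrow> Y t \<omega> = Z n \<omega>"
    using assms unfolding ctmc_from_def by blast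
  let ?D = "\<lambda>\<omega>. (\<Sum>k. ennreal (S k \<omega>) * of_bool (\<forall>i\<in>{0<..k}. Z i \<omega> \<noteq> x))"
  have D: "(\<integral>\<^sup>+\<omega>. ?D \<omega> \<partial>M) = (\<Sum>k. (killed_step q (- {x}) ^^ k) mean_hold x)"
    by (rule nn_integral_excursion[OF M law])
  have "AE \<omega> in M. ?D \<omega> \<le> return_time Y x \<omega>"
    using AE_regular[OF M law] Y by eventually_elim (intro sum_le_return_time, auto)
  then have lower: "(\<integral>\<^sup>+\<omega>. ?D \<omega> \<partial>M) \<le> (\<integral>\<^sup>+\<omega>. return_time Y x \<omega> \<partial>M)"
    by (rule nn_integral_mono_AE)
  have upper: "(\<integral>\<^sup>+\<omega>. return_time Y x \<omega> \<partial>M) \<le> (\<integral>\<^sup>+\<omega>. ?D \<omega> \<partial>M)"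
    if "(\<Sum>k. (killed_step q (- {x}) ^^ k) mean_hold x) < \<infinity>"
  proof (rule nn_integral_mono_AE)
    show "AE \<omega> in M. return_time Y x \<omega> \<le> ?D \<omega>"
      using AE_regular[OF M law] AE_returns[OF M law that] Y
      by eventually_elim (intro return_time_le_sum, auto)
  qed
  show ?thesis
    using lower upper unfolding D by (auto intro: le_less_trans)
qed

end

section \<open>Drift criteria\<close>

context bounded_rates
begin

text \<open>
  The generator of the chain. Drift conditions are stated for it rather than for the jump chain
  since it involves the rates without the normalisation by exit rates.
\<close>

definition gen :: "('s \<Rightarrow> real) \<Rightarrow> 's \<Rightarrow> real" where
  "gen V y = (\<Sum>z\<in>succ y. q y z * (V z - V y))"

lemma gen_superset:
  assumes "finite B" "\<And>z. z \<noteq> y \<Longrightarrow> q y z \<noteq> 0 \<Longrightarrow> z \<in> B"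
  shows "gen V y = (\<Sum>z\<in>B. q y z * (V z - V y))"
  unfolding gen_def using assms by (intro sum.mono_neutral_left) auto

lemma gen_add: "gen (\<lambda>y. V y + W y) y = gen V y + gen W y"
  unfolding gen_def sum.distrib[symmetric] by (intro sum.cong) (auto simp: algebra_simps)

lemma gen_cmult: "gen (\<lambda>y. c * V y) y = c * gen V y"
  unfolding gen_def sum_distrib_left by (intro sum.cong) (auto simp: algebra_simps)

lemma jump_mean_eq_gen: "(\<Sum>z\<in>succ y. q y z / exit_rate q y * V z) = V y + gen V y / exit_rate q y"
proof -
  have "gen V y = (\<Sum>z\<in>succ y. q y z * V z) - (\<Sum>z\<in>succ y. q y z) * V y"
    unfolding gen_def by (simp add: right_diff_distrib sum_subtractf sum_distrib_right)
  then have "(\<Sum>z\<in>succ y. q y z * V z) = exit_rate q y * V y + gen V y"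
    by (simp add: exit_rate_eq)
  then have "(\<Sum>z\<in>succ y. q y z * V z) / exit_rate q y = V y + gen V y / exit_rate q y"
    using exit_pos[of y] by (simp add: field_simps)
  then show ?thesis
    by (simp add: sum_divide_distrib)
qed

lemma killed_step_ennreal:
  assumes "\<And>z. V z \<ge> 0"
  shows "killed_step q A (\<lambda>z. ennreal (V z)) y =
    ennreal (\<Sum>z\<in>succ y. q y z / exit_rate q y * (indicator A z * V z))"
proof -
  have "killed_step q A (\<lambda>z. ennreal (V z)) y =
      (\<Sum>z\<in>succ y. ennreal (q y z / exit_rate q y * (indicator A z * V z)))"
    unfolding killed_step_eq_sum using assms rate_nonneg exit_pos[of y]
    by (intro sum.cong refl)
      (auto simp: ennreal_mult less_imp_le simp del: times_divide_eq_left split: split_indicator)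
  also have "\<dots> = ennreal (\<Sum>z\<in>succ y. q y z / exit_rate q y * (indicator A z * V z))"
    using assms rate_nonneg exit_pos[of y]
    by (intro sum_ennreal mult_nonneg_nonneg divide_nonneg_pos) auto
  finally show ?thesis .
qed

text \<open>
  The time spent before hitting \<open>x\<close> is the least nonnegative solution of \<open>h = m + T h\<close> off \<open>x\<close>, where
  \<open>m\<close> is the mean holding time and \<open>T\<close> the kernel killed at \<open>x\<close>. The drift condition says
  \<open>V \<ge> m + T V\<close>, so \<open>V\<close> dominates every partial sum of that solution.
\<close>

lemma killed_sum_le_of_drift:
  assumes V: "\<And>y. V y \<ge> 0" and drift: "\<And>y. y \<noteq> x \<Longrightarrow> gen V y \<le> -1" and "y \<noteq> x"
  shows "(\<Sum>k<n. (killed_step q (- {x}) ^^ k) mean_hold y) \<le> ennreal (V y)"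
  using \<open>y \<noteq> x\<close>
proof (induction n arbitrary: y)
  case (Suc n)
  let ?T = "killed_step q (- {x})"
  have "(\<Sum>k<Suc n. (?T ^^ k) mean_hold y) = mean_hold y + (\<Sum>k<n. ?T ((?T ^^ k) mean_hold) y)"
    by (simp only: sum.lessThan_Suc_shift funpow.simps o_apply id_apply)
  also have "(\<Sum>k<n. ?T ((?T ^^ k) mean_hold) y) = ?T (\<lambda>y. \<Sum>k<n. (?T ^^ k) mean_hold y) y"
    by (simp add: killed_step_sum)
  also have "\<dots> \<le> ?T (\<lambda>y. ennreal (V y)) y"
    by (intro killed_step_mono Suc.IH) auto
  also have "\<dots> \<le> killed_step q UNIV (\<lambda>y. ennreal (V y)) y"
    unfolding killed_step_def by (intro nn_integral_mono) (auto split: split_indicator)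
  also have "\<dots> = ennreal (V y + gen V y / exit_rate q y)"
    unfolding killed_step_ennreal[OF V] by (simp add: jump_mean_eq_gen del: times_divide_eq_left)
  also have "\<dots> \<le> ennreal (V y - 1 / exit_rate q y)"
    using divide_right_mono[OF drift[OF Suc.prems], of "exit_rate q y"] exit_pos[of y]
    by (intro ennreal_leI) simp
  finally have "(\<Sum>k<Suc n. (?T ^^ k) mean_hold y) \<le> mean_hold y + ennreal (V y - 1 / exit_rate q y)"
    by (simp add: add_left_mono)
  also have "\<dots> = ennreal (V y)"
  proof -
    have "0 \<le> (\<Sum>z\<in>succ y. q y z / exit_rate q y * V z)"
      using V rate_nonneg exit_pos[of y] by (intro sum_nonneg mult_nonneg_nonneg divide_nonneg_pos) auto
    then have "0 \<le> V y + gen V y / exit_rate q y" by (simp only: jump_mean_eq_gen)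
    moreover have "gen V y / exit_rate q y \<le> - 1 / exit_rate q y"
      using drift[OF Suc.prems] exit_pos[of y] by (intro divide_right_mono) auto
    ultimately have "0 \<le> V y - 1 / exit_rate q y" by simp
    then show ?thesis using exit_pos[of y] by (simp add: ennreal_plus[symmetric] less_imp_le del: ennreal_plus)
  qed
  finally show ?case .
qed simp

lemma excursion_finite_of_drift:
  assumes V: "\<And>y. V y \<ge> 0" and drift: "\<And>y. y \<noteq> x \<Longrightarrow> gen V y \<le> -1"
  shows "(\<Sum>k. (killed_step q (- {x}) ^^ k) mean_hold x) < \<infinity>"
proof -
  let ?T = "killed_step q (- {x})"
  have "(\<Sum>k<n. (?T ^^ k) mean_hold x) \<le> mean_hold x + ?T (\<lambda>y. ennreal (V y)) x" for n
  proof (cases n)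
    case (Suc m)
    have "(\<Sum>k<Suc m. (?T ^^ k) mean_hold x) = mean_hold x + (\<Sum>k<m. ?T ((?T ^^ k) mean_hold) x)"
      by (simp only: sum.lessThan_Suc_shift funpow.simps o_apply id_apply)
    also have "(\<Sum>k<m. ?T ((?T ^^ k) mean_hold) x) = ?T (\<lambda>y. \<Sum>k<m. (?T ^^ k) mean_hold y) x"
      by (simp add: killed_step_sum)
    also have "\<dots> \<le> ?T (\<lambda>y. ennreal (V y)) x"
      by (intro killed_step_mono killed_sum_le_of_drift assms) auto
    finally show ?thesis using Suc by (simp add: add_left_mono)
  qed simp
  then have "(\<Sum>k. (?T ^^ k) mean_hold x) \<le> mean_hold x + ?T (\<lambda>y. ennreal (V y)) x"
    by (intro suminf_le_const) auto
  also have "\<dots> < \<infinity>"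
    using V by (simp add: killed_step_ennreal)
  finally show ?thesis .
qed

lemma distance_function:
  assumes "irreducible_rates q"
  obtains d :: "'s \<Rightarrow> nat" where "d x = 0"
    and "\<And>y. y \<noteq> x \<Longrightarrow> \<exists>z\<in>succ y. d y = Suc (d z)"
proof -
  define E where "E = {(a, b). a \<noteq> b \<and> q a b > 0}"
  define d where "d y = (LEAST n. (y, x) \<in> E ^^ n)" for y
  have ex: "\<exists>n. (y, x) \<in> E ^^ n" for y
    using assms unfolding irreducible_rates_def E_def by (metis rtrancl_power)
  have d: "(y, x) \<in> E ^^ d y" for y
    unfolding d_def using ex[of y] by (rule LeastI_ex)
  have d_le: "d y \<le> n" if "(y, x) \<in> E ^^ n" for y n
    unfolding d_def using that by (rule Least_le)
  show thesis
  proof (rule that)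
    show "d x = 0" using d_le[of x 0] by simp
    fix y assume "y \<noteq> x"
    have "d y \<noteq> 0" using d[of y] \<open>y \<noteq> x\<close> by (auto intro: ccontr)
    then obtain m where m: "d y = Suc m" using not0_implies_Suc by blast
    then have "(y, x) \<in> E ^^ Suc m" using d[of y] by simp
    then obtain z where z: "(y, z) \<in> E" "(z, x) \<in> E ^^ m" by (rule relpow_Suc_E2)
    then have "(y, x) \<in> E ^^ Suc (d z)" using relpow_Suc_I2[OF z(1) d[of z]] by simp
    then have "d y = Suc (d z)" using d_le m z(2) by (metis Suc_le_mono le_antisym)
    moreover have "z \<in> succ y" using z(1) by (auto simp: E_def)
    ultimately show "\<exists>z\<in>succ y. d y = Suc (d z)" by blast
  qed
qed

text \<open>
  In an irreducible chain some bounded function has negative drift everywhere off \<open>x\<close>, though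
  with no uniform rate. With \<open>d\<close> the number of jumps needed to reach \<open>x\<close>, take \<open>1 - b ^ d\<close>: the
  gain from one neighbour closer to \<open>x\<close> is of order \<open>r * b ^ (d - 1)\<close>, while jumps to all other
  neighbours cost at most \<open>R * b ^ d\<close>, which is less when \<open>b\<close> is small.
\<close>

lemma bounded_strict_drift:
  assumes "irreducible_rates q"
  obtains w where "\<And>y. w y \<ge> 0" "\<And>y. y \<noteq> x \<Longrightarrow> gen w y < 0"
proof -
  obtain d where d: "d x = 0" "\<And>y. y \<noteq> x \<Longrightarrow> \<exists>z\<in>succ y. d y = Suc (d z)"
    using distance_function[OF assms, where x = x] by blast
  have R: "R > 0" using exit_pos[of x] exit_le[of x] by linarith
  define b where "b = min (1 / 2) (r / (2 * R))"
  have b: "0 < b" "b \<le> 1" "R * b < r"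
  proof -
    show "0 < b" "b \<le> 1" using r_pos R by (auto simp: b_def)
    have "R * b \<le> R * (r / (2 * R))" using R by (intro mult_left_mono) (auto simp: b_def)
    also have "\<dots> < r" using R r_pos by simp
    finally show "R * b < r" .
  qed
  define w where "w y = 1 - b ^ d y" for y
  show thesis
  proof (rule that)
    show "w y \<ge> 0" for y using b by (simp add: w_def power_le_one)
    fix y assume "y \<noteq> x"
    then obtain z where z: "z \<in> succ y" and dz: "d y = Suc (d z)" using d(2) by blast
    have "gen w y = (\<Sum>u\<in>succ y. q y u * b ^ d y) - (\<Sum>u\<in>succ y. q y u * b ^ d u)"
      unfolding gen_def sum_subtractf[symmetric] by (simp add: w_def right_diff_distrib)
    also have "(\<Sum>u\<in>succ y. q y u * b ^ d y) = exit_rate q y * b ^ d y"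
      by (simp add: exit_rate_eq sum_distrib_right)
    finally have "gen w y = exit_rate q y * b ^ d y - (\<Sum>u\<in>succ y. q y u * b ^ d u)" .
    moreover have "q y z * b ^ d z \<le> (\<Sum>u\<in>succ y. q y u * b ^ d u)"
      using z finite_succ rate_nonneg b by (intro member_le_sum) auto
    moreover have "r * b ^ d z \<le> q y z * b ^ d z"
      using z rate_ge b by (intro mult_right_mono) auto
    moreover have "exit_rate q y * b ^ d y \<le> R * b ^ d y"
      using exit_le b by (intro mult_right_mono) auto
    moreover have "R * b ^ d y - r * b ^ d z = (R * b - r) * b ^ d z"
      by (simp add: dz algebra_simps)
    moreover have "(R * b - r) * b ^ d z < 0"
      using b by (intro mult_neg_pos) auto
    ultimately show "gen w y < 0" by linarith
  qed
qed

text \<open>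
  Foster's criterion for the return time to a single state. Drift only outside a finite set is
  repaired by adding a multiple of the bounded function with strictly negative drift; on a finite
  set a large enough multiple compensates whatever \<open>V\<close> does there.
\<close>

theorem foster:
  assumes irr: "irreducible_rates q" and V: "\<And>y. V y \<ge> 0" and F: "finite F"
    and drift: "\<And>y. y \<notin> F \<Longrightarrow> gen V y \<le> -1"
  shows "(\<Sum>k. (killed_step q (- {x}) ^^ k) mean_hold x) < \<infinity>"
proof -
  obtain w where w: "\<And>y. w y \<ge> 0" "\<And>y. y \<noteq> x \<Longrightarrow> gen w y < 0"
    using bounded_strict_drift[OF irr, where x = x] by blast
  define c where "c = (\<Sum>y\<in>F - {x}. \<bar>gen V y + 1\<bar> / (- gen w y))"
  have c: "c \<ge> 0" unfolding c_def using w(2) by (intro sum_nonneg divide_nonneg_pos) auto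
  define W where "W y = V y + c * w y" for y
  have gW: "gen W y = gen V y + c * gen w y" for y
    unfolding W_def gen_add gen_cmult ..
  show ?thesis
  proof (rule excursion_finite_of_drift)
    show "W y \<ge> 0" for y using V w(1) c by (simp add: W_def)
    fix y assume "y \<noteq> x"
    show "gen W y \<le> -1"
    proof (cases "y \<in> F")
      case True
      have neg: "- gen w y > 0" using w(2) \<open>y \<noteq> x\<close> by simp
      have "\<bar>gen V y + 1\<bar> / (- gen w y) \<le> c"
        unfolding c_def using True \<open>y \<noteq> x\<close> F w(2)
        by (intro member_le_sum[of y "F - {x}" "\<lambda>y. \<bar>gen V y + 1\<bar> / (- gen w y)"] divide_nonneg_pos) auto
      then have "\<bar>gen V y + 1\<bar> \<le> c * (- gen w y)"
        using neg by (simp only: pos_divide_le_eq)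
      then show ?thesis by (simp add: gW)
    next
      case False
      have "c * gen w y \<le> 0"
        using c w(2)[OF \<open>y \<noteq> x\<close>] by (intro mult_nonneg_nonpos) auto
      then show ?thesis using drift[OF False] by (simp add: gW)
    qed
  qed
qed

text \<open>
  The converse criterion. As \<open>L\<close> vanishes at \<open>x\<close>, killing at \<open>x\<close> does not affect it, so the
  submartingale property gives \<open>L y \<le> (T ^^ n) L y\<close>. In \<open>n\<close> jumps \<open>L\<close> grows by at most \<open>K * n\<close>,
  hence \<open>L y \<le> (L y + K * n) * p n\<close> with \<open>p n\<close> the probability of not having met \<open>x\<close> within \<open>n\<close>
  jumps. So \<open>p n\<close> decays no faster than \<open>1 / n\<close>, and the harmonic series diverges.
\<close>

theorem excursion_infinite_of_submartingale:
  assumes L: "\<And>y. L y \<ge> 0" and drift: "\<And>y. gen L y \<ge> 0" and x: "L x = 0"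
    and K: "\<And>y z. z \<in> succ y \<Longrightarrow> L z \<le> L y + K"
    and y0: "y0 \<in> succ x" "L y0 > 0"
  shows "(\<Sum>k. (killed_step q (- {x}) ^^ k) mean_hold x) = \<infinity>"
proof (rule ccontr)
  assume fin: "(\<Sum>k. (killed_step q (- {x}) ^^ k) mean_hold x) \<noteq> \<infinity>"
  let ?T = "killed_step q (- {x})"
  have R: "R > 0" using exit_pos[of x] exit_le[of x] by linarith
  have K0: "K > 0" using K[OF y0(1)] x y0(2) by simp
  have sub: "ennreal (L y) \<le> ?T (\<lambda>z. ennreal (L z)) y" for y
  proof -
    have "(\<Sum>z\<in>succ y. q y z / exit_rate q y * (indicator (- {x}) z * L z)) =
        (\<Sum>z\<in>succ y. q y z / exit_rate q y * L z)"
      using x by (intro sum.cong) (auto split: split_indicator)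
    also have "\<dots> \<ge> L y"
      using drift[of y] exit_pos[of y] by (simp add: jump_mean_eq_gen less_imp_le del: times_divide_eq_left)
    finally show ?thesis
      using killed_step_ennreal[of L "- {x}" y] L by (simp add: ennreal_leI)
  qed
  have lower: "ennreal (L y) \<le> (?T ^^ n) (\<lambda>z. ennreal (L z)) y" for n y
  proof (induction n arbitrary: y)
    case (Suc n)
    have "ennreal (L y) \<le> ?T (\<lambda>z. ennreal (L z)) y" by (rule sub)
    also have "\<dots> \<le> ?T ((?T ^^ n) (\<lambda>z. ennreal (L z))) y"
      by (intro killed_step_mono Suc.IH)
    finally show ?case by simp
  qed simp
  \<comment> \<open>The factor \<open>R\<close> pays for comparing the constant function 1 with the mean holding time.\<close>
  have upper: "(?T ^^ n) (\<lambda>z. ennreal (L z)) y \<le>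
      ennreal (R * (L y + K * n)) * (?T ^^ n) mean_hold y" for n y
  proof (induction n arbitrary: y)
    case 0
    have "L y \<le> R * L y * (1 / exit_rate q y)"
    proof -
      have "exit_rate q y * L y \<le> R * L y" using exit_le L by (intro mult_right_mono)
      then show ?thesis using exit_pos[of y] by (simp add: field_simps)
    qed
    then show ?case using R L exit_pos[of y]
      by (simp add: ennreal_mult[symmetric] ennreal_leI less_imp_le)
  next
    case (Suc n)
    have "?T ((?T ^^ n) (\<lambda>z. ennreal (L z))) y \<le>
        ?T (\<lambda>z. ennreal (R * (L z + K * n)) * (?T ^^ n) mean_hold z) y"
      by (intro killed_step_mono Suc.IH)
    also have "\<dots> \<le> (\<Sum>z\<in>succ y. ennreal (q y z / exit_rate q y) * indicator (- {x}) z *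
        (ennreal (R * (L y + K * Suc n)) * (?T ^^ n) mean_hold z))"
      unfolding killed_step_eq_sum
    proof (intro sum_mono mult_left_mono mult_right_mono ennreal_leI)
      fix z assume "z \<in> succ y"
      then show "L z + K * real n \<le> L y + K * real (Suc n)"
        using K[of z y] by (simp add: algebra_simps)
    qed (use R in auto)
    also have "\<dots> = ennreal (R * (L y + K * Suc n)) * ?T ((?T ^^ n) mean_hold) y"
      unfolding killed_step_eq_sum by (simp add: sum_distrib_left ac_simps)
    finally show ?case by simp
  qed
  define a where "a n = enn2real ((?T ^^ n) mean_hold x)" for n
  have fin_n: "(?T ^^ n) mean_hold x < top" for n
    using ennreal_suminf_lessD[of "\<lambda>k. (?T ^^ k) mean_hold x" top n] fin by (simp add: less_top)
  have a: "ennreal (a n) = (?T ^^ n) mean_hold x" for n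
    unfolding a_def using fin_n by (simp add: less_top)
  have "summable a"
  proof (rule summable_suminf_not_top)
    show "0 \<le> a n" for n by (simp add: a_def)
    show "(\<Sum>n. ennreal (a n)) \<noteq> top" using fin by (simp add: a)
  qed
  then have "summable (\<lambda>n. a (Suc n))" by (simp add: summable_Suc_iff)
  define p where "p = q x y0 / exit_rate q x"
  have p: "p > 0" using y0(1) rate_nonneg[of x y0] exit_pos[of x] by (auto simp: p_def less_le)
  define e where "e = p * L y0 / (R * (L y0 + K))"
  have e: "e > 0" using p R K0 y0(2) by (simp add: e_def)
  have bound: "e * (1 / real (Suc n)) \<le> a (Suc n)" for n
  proof -
    have step: "ennreal p * (?T ^^ n) mean_hold y0 \<le> ennreal (a (Suc n))"
      using y0(1) killed_step_ge_single[of y0 "- {x}" q x "(?T ^^ n) mean_hold"]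
      by (simp add: jump_prob_def p_def a)
    have "ennreal (p * L y0) = ennreal p * ennreal (L y0)"
      using p L by (simp add: ennreal_mult)
    also have "\<dots> \<le> ennreal p * (ennreal (R * (L y0 + K * n)) * (?T ^^ n) mean_hold y0)"
      using order_trans[OF lower upper] by (intro mult_left_mono) auto
    also have "\<dots> = ennreal (R * (L y0 + K * n)) * (ennreal p * (?T ^^ n) mean_hold y0)"
      by (simp add: ac_simps)
    also have "\<dots> \<le> ennreal (R * (L y0 + K * n)) * ennreal (a (Suc n))"
      using step by (rule mult_left_mono) simp
    also have "\<dots> =
        ennreal (R * (L y0 + K * n) * a (Suc n))"
      using R K0 L by (intro ennreal_mult[symmetric]) (auto simp: a_def)
    finally have "p * L y0 \<le> R * (L y0 + K * n) * a (Suc n)"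
      using R K0 L by (subst (asm) ennreal_le_iff) (auto simp: a_def mult_left_mono)
    also have "\<dots> \<le> R * ((L y0 + K) * Suc n) * a (Suc n)"
      using R K0 L[of y0] by (intro mult_right_mono mult_left_mono) (auto simp: a_def algebra_simps)
    finally have "p * L y0 \<le> a (Suc n) * (R * ((L y0 + K) * Suc n))"
      by (simp only: mult.commute)
    moreover have "R * ((L y0 + K) * Suc n) > 0"
      using R K0 y0(2) by simp
    ultimately have "p * L y0 / (R * ((L y0 + K) * Suc n)) \<le> a (Suc n)"
      by (simp only: pos_divide_le_eq)
    then show ?thesis by (simp add: e_def)
  qed
  have "summable (\<lambda>n. e * (1 / real (Suc n)))"
    by (rule summable_comparison_test'[OF \<open>summable (\<lambda>n. a (Suc n))\<close>, of 0])
      (use bound e in auto)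
  then have "summable (\<lambda>n. 1 / real (Suc n))"
    by (rule summable_mult_D) (use e in simp)
  then have "summable (\<lambda>n. 1 / real n)"
    by (rule iffD1[OF summable_Suc_iff[where f = "\<lambda>n. 1 / real n"]])
  then show False
    using not_summable_harmonic[where 'a = real] by (simp add: inverse_eq_divide)
qed

end

section \<open>The retrial system\<close>

lemma retrial_bounded_rates:
  assumes pos: "lam > 0" "mu > 0" "alpha > 0"
  shows "bounded_rates (retrial_rate lam mu alpha) (min (lam / 2) (min mu alpha)) (lam + mu + 2 * alpha)"
proof
  fix y z :: state
  obtain i j c where y: "y = (i, j, c)" by (cases y)
  show "0 < min (lam / 2) (min mu alpha)" using pos by simp
  show "0 \<le> retrial_rate lam mu alpha y z" using pos unfolding y by (cases c) auto
  have "retrial_rate lam mu alpha y z \<in> {0, lam / 2, lam, mu, alpha}"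
    unfolding y by (cases c) simp_all
  moreover have "min (lam / 2) (min mu alpha) \<le> lam / 2" "min (lam / 2) (min mu alpha) \<le> lam"
    "min (lam / 2) (min mu alpha) \<le> mu" "min (lam / 2) (min mu alpha) \<le> alpha"
    using pos by linarith+
  ultimately show "min (lam / 2) (min mu alpha) \<le> retrial_rate lam mu alpha y z"
    if "retrial_rate lam mu alpha y z \<noteq> 0"
    using that by (elim insertE emptyE) simp_all
  define B where "B = {(i, j, True), (i - 1, j, True), (i, j - 1, True), (i, j, False),
    (i + 1, j, True), (i, j + 1, True)}"
  have "retrial_rate lam mu alpha y w = 0" if "w \<notin> B" for w
    using that unfolding y B_def by (cases c) simp_all
  then have "{z. z \<noteq> y \<and> retrial_rate lam mu alpha y z \<noteq> 0} \<subseteq> B" by blast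
  moreover have "finite B" by (simp only: B_def finite.intros)
  ultimately show "finite {z. z \<noteq> y \<and> retrial_rate lam mu alpha y z \<noteq> 0}"
    by (rule finite_subset)
  show "0 < exit_rate (retrial_rate lam mu alpha) y"
    "exit_rate (retrial_rate lam mu alpha) y \<le> lam + mu + 2 * alpha"
    using pos unfolding y by (cases c; simp add: exit_rate_retrial_idle exit_rate_retrial_busy)+
qed

locale retrial =
  fixes lam mu alpha :: real
  assumes pos: "lam > 0" "mu > 0" "alpha > 0"
begin

sublocale bounded_rates "retrial_rate lam mu alpha" "min (lam / 2) (min mu alpha)"
  "lam + mu + 2 * alpha"
  by (rule retrial_bounded_rates[OF pos])

lemma gen_idle:
  "gen V (i, j, False) = lam * (V (i, j, True) - V (i, j, False))
    + (if i > 0 then alpha * (V (i - 1, j, True) - V (i, j, False)) else 0)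
    + (if j > 0 then alpha * (V (i, j - 1, True) - V (i, j, False)) else 0)"
proof -
  let ?B = "{(i, j, True)} \<union> (if i > 0 then {(i - 1, j, True)} else {})
      \<union> (if j > 0 then {(i, j - 1, True)} else {})"
  have "gen V (i, j, False) =
      (\<Sum>z\<in>?B. retrial_rate lam mu alpha (i, j, False) z * (V z - V (i, j, False)))"
    by (rule gen_superset) (auto split: if_splits)
  then show ?thesis by auto
qed

lemma gen_busy:
  "gen V (i, j, True) = mu * (V (i, j, False) - V (i, j, True))
    + (if i < j then lam else if i = j then lam / 2 else 0) * (V (i + 1, j, True) - V (i, j, True))
    + (if j < i then lam else if i = j then lam / 2 else 0) * (V (i, j + 1, True) - V (i, j, True))"
proof -
  have "gen V (i, j, True) = (\<Sum>z\<in>{(i, j, False), (i + 1, j, True), (i, j + 1, True)}.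
      retrial_rate lam mu alpha (i, j, True) z * (V z - V (i, j, True)))"
    by (rule gen_superset) (auto split: if_splits)
  then show ?thesis by simp
qed

text \<open>
  Joining the shorter orbit makes \<open>i\<^sup>2 + j\<^sup>2\<close> grow at rate at most \<open>lam * (i + j)\<close> up to constants
  while the server is busy, since \<open>2 * min i j \<le> i + j\<close>; retrials decrease it at rate
  \<open>2 * alpha * (i + j)\<close> while the server is idle, whether or not one of the orbits is empty. The
  term with \<open>b\<close> lets the two phases pay for each other.
\<close>

fun quad :: "real \<Rightarrow> state \<Rightarrow> real" where
  "quad b (i, j, c) = real i ^ 2 + real j ^ 2 + (if c then b * real (i + j) else 0)"

lemma gen_quad_idle:
  assumes "b \<ge> 0"
  shows "gen (quad b) (i, j, False) \<le> (b * (lam + 2 * alpha) - 2 * alpha) * real (i + j) + 2 * alpha"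
proof -
  have b1: "- (alpha * b) \<le> 0" "0 \<le> alpha * b * real i" "0 \<le> alpha * b * real j"
    using assms pos by auto
  show ?thesis
  proof (cases i; cases j)
    fix m n assume "i = Suc m" "j = Suc n"
    then show ?thesis using b1 pos
      by (simp add: gen_idle power2_eq_square algebra_simps)
  next
    fix m assume "i = Suc m" "j = 0"
    then show ?thesis using b1 pos
      by (simp add: gen_idle power2_eq_square algebra_simps)
  next
    fix n assume "i = 0" "j = Suc n"
    then show ?thesis using b1 pos
      by (simp add: gen_idle power2_eq_square algebra_simps)
  next
    assume "i = 0" "j = 0"
    then show ?thesis using pos by (simp add: gen_idle)
  qed
qed

lemma gen_quad_busy:
  "gen (quad b) (i, j, True) \<le> (lam - b * mu) * real (i + j) + lam * (1 + b)"
proof -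
  consider "i < j" | "i = j" | "j < i" by linarith
  then show ?thesis
  proof cases
    case 1
    then have "lam * real i \<le> lam * real j" using pos by simp
    with 1 show ?thesis by (simp add: gen_busy power2_eq_square algebra_simps)
  next
    case 2
    then show ?thesis by (simp add: gen_busy power2_eq_square algebra_simps)
  next
    case 3
    then have "lam * real j \<le> lam * real i" using pos by simp
    with 3 show ?thesis by (simp add: gen_busy power2_eq_square algebra_simps)
  qed
qed

text \<open>
  Negative drift of \<open>quad b\<close> needs \<open>lam < b * mu\<close> in busy states and
  \<open>b * (lam + 2 * alpha) < 2 * alpha\<close> in idle ones. Such a \<open>b\<close> exists exactly when
  \<open>lam * (lam + 2 * alpha) < 2 * alpha * mu\<close>.
\<close>

lemma excursion_finite:
  assumes rho: "lam * (lam + 2 * alpha) < 2 * alpha * mu"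
  shows "(\<Sum>k. (killed_step (retrial_rate lam mu alpha) (- {x}) ^^ k) mean_hold x) < \<infinity>"
proof -
  have "lam / mu < 2 * alpha / (lam + 2 * alpha)"
    using rho pos by (simp add: field_simps)
  then obtain b where b: "lam / mu < b" "b < 2 * alpha / (lam + 2 * alpha)"
    using dense by blast
  have b0: "b > 0" using b(1) pos by (meson divide_pos_pos less_trans)
  have neg: "b * (lam + 2 * alpha) - 2 * alpha < 0" "lam - b * mu < 0"
    using b pos by (simp_all add: field_simps)
  define k where "k = min (2 * alpha - b * (lam + 2 * alpha)) (b * mu - lam)"
  define K where "K = 2 * alpha + lam * (1 + b)"
  have k: "k > 0" using neg by (simp add: k_def)
  have drift: "gen (quad b) (i, j, c) \<le> K - k * real (i + j)" for i j c
  proof (cases c)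
    case True
    have "(lam - b * mu) * real (i + j) \<le> - k * real (i + j)"
      by (intro mult_right_mono) (auto simp: k_def)
    with gen_quad_busy[of b i j] True pos show ?thesis by (simp add: K_def)
  next
    case False
    have "(b * (lam + 2 * alpha) - 2 * alpha) * real (i + j) \<le> - k * real (i + j)"
      by (intro mult_right_mono) (auto simp: k_def)
    moreover have "0 \<le> lam * (1 + b)" using b0 pos by simp
    ultimately show ?thesis using gen_quad_idle[of b i j] False b0 by (simp add: K_def)
  qed
  obtain N :: nat where N: "(K + 1) / k \<le> real N" using real_arch_simple by blast
  show ?thesis
  proof (rule foster)
    show "irreducible_rates (retrial_rate lam mu alpha)"
      by (rule irreducible_retrial_rate[OF pos])
    show "quad b y \<ge> 0" for y using b0 by (cases y) simp
    show "finite ({..N} \<times> {..N} \<times> (UNIV :: bool set))" by simp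
    fix y :: state assume y: "y \<notin> {..N} \<times> {..N} \<times> UNIV"
    obtain i j c where ijc: "y = (i, j, c)" by (cases y)
    have "real N \<le> real (i + j)" using y ijc by auto
    with N have "(K + 1) / k \<le> real (i + j)" by linarith
    then have "K + 1 \<le> k * real (i + j)" using k by (simp add: field_simps)
    with drift[of i j c] show "gen (quad b) y \<le> -1" by (simp add: ijc)
  qed
qed

text \<open>
  The number of jobs in orbit, with a job in service counted as a fraction \<open>a\<close> of one.
\<close>

fun lin :: "real \<Rightarrow> state \<Rightarrow> real" where
  "lin a (i, j, c) = real i + real j + (if c then a else 0)"

text \<open>
  The value of \<open>a\<close> makes the drift of \<open>lin a\<close> vanish in idle states with two nonempty orbits. An
  empty orbit only removes a negative term \<open>alpha * (a - 1)\<close>, so the drift is nonnegative in all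
  idle states, and in busy states it equals \<open>lam - mu * a\<close>, which is nonnegative at or above the
  critical load.
\<close>

lemma excursion_infinite:
  assumes rho: "lam * (lam + 2 * alpha) \<ge> 2 * alpha * mu"
  shows "(\<Sum>k. (killed_step (retrial_rate lam mu alpha) (- {(0, 0, False)}) ^^ k) mean_hold (0, 0, False)) = \<infinity>"
proof -
  define a where "a = 2 * alpha / (lam + 2 * alpha)"
  have a: "0 < a" "a < 1" using pos by (simp_all add: a_def)
  have idle: "lam * a + 2 * alpha * (a - 1) = 0" using pos by (simp add: a_def field_simps)
  have "mu * a \<le> lam" using rho pos by (simp add: a_def field_simps)
  have le: "alpha * (a - 1) \<le> 0" using a pos by (intro mult_nonneg_nonpos) auto
  show ?thesis
  proof (rule excursion_infinite_of_submartingale)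
    show "lin a y \<ge> 0" for y using a by (cases y) simp
    show "lin a (0, 0, False) = 0" by simp
    show "lin a (0, 0, True) > 0" using a by simp
    show "(0, 0, True) \<in> succ (0, 0, False)" using pos by simp
    show "lin a z \<le> lin a y + 1" if "z \<in> succ y" for y z
    proof -
      obtain i j c where "y = (i, j, c)" by (cases y)
      then show ?thesis using that a by (cases c) (auto split: if_splits)
    qed
    show "gen (lin a) y \<ge> 0" for y
    proof -
      obtain i j c where y: "y = (i, j, c)" by (cases y)
      show ?thesis
      proof (cases c)
        case True
        have "gen (lin a) y = lam - mu * a"
          unfolding y using True by (auto simp: gen_busy)
        then show ?thesis using \<open>mu * a \<le> lam\<close> by simp
      next
        case False
        have "gen (lin a) y = lam * a + (if i > 0 then alpha * (a - 1) else 0)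
            + (if j > 0 then alpha * (a - 1) else 0)"
          unfolding y using False by (auto simp: gen_idle of_nat_diff)
        then show ?thesis using idle le a pos by (auto split: if_splits)
      qed
    qed
  qed
qed

end

theorem mainTheorem3:
  fixes lam mu alpha :: real
    and P :: "state \<Rightarrow> 'w measure"
    and Y :: "real \<Rightarrow> 'w \<Rightarrow> state"
  assumes "lam > 0" and "mu > 0" and "alpha > 0"
    and "ctmc P (retrial_rate lam mu alpha) Y"
  shows "positive_recurrent P Y \<longleftrightarrow> lam * (lam + 2 * alpha) / (2 * alpha * mu) < 1"
proof -
  interpret retrial lam mu alpha by standard (fact assms)+
  have iff: "(\<integral>\<^sup>+\<omega>. return_time Y x \<omega> \<partial>P x) < \<infinity> \<longleftrightarrow>
      (\<Sum>k. (killed_step (retrial_rate lam mu alpha) (- {x}) ^^ k) mean_hold x) < \<infinity>" for x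
    using assms(4) unfolding ctmc_def by (intro return_time_finite_iff) blast
  have "lam * (lam + 2 * alpha) / (2 * alpha * mu) < 1 \<longleftrightarrow>
      lam * (lam + 2 * alpha) < 2 * alpha * mu"
    using pos by simp
  moreover have "positive_recurrent P Y" if "lam * (lam + 2 * alpha) < 2 * alpha * mu"
    unfolding positive_recurrent_def iff using excursion_finite[OF that] by blast
  moreover have "\<not> positive_recurrent P Y" if "\<not> lam * (lam + 2 * alpha) < 2 * alpha * mu"
  proof -
    have "lam * (lam + 2 * alpha) \<ge> 2 * alpha * mu" using that by simp
    from excursion_infinite[OF this] show ?thesis
      unfolding positive_recurrent_def iff by (metis less_irrefl)
  qed
  ultimately show ?thesis by blast
qed

end
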